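(* Let $\Omega\subset\mathbb{R}^n$ be open and $u\in C^2(\Omega)$. For each $x\in\Omega$ let $\mathbb{A}_x$ be a non-empty collection of subsets of $S^n_+(\mathbb{R})$ such that $$\bigcup\mathbb{A}_x=\{A\in S^n_+(\mathbb{R}):A\in\mathcal{A}\text{ for some }\mathcal{A}\in\mathbb{A}_x\}\quad\text{is bounded},$$ and let $F:\Omega\times S^n(\mathbb{R})\to\mathbb{R}$ be given by $$F(x,M)=\sup_{\mathcal{A}\in\mathbb{A}_x}\ \inf_{A\in\mathcal{A}}\operatorname{trace}(A^tMA).$$ Then, for every $x\in\Omega$, $$F\big(x,D^2u(x)\big)=2(n+2)\sup_{\mathcal{A}\in\mathbb{A}_x}\ \inf_{A\in\mathcal{A}}\ \frac{1}{|B_\varepsilon(0)|}\int_{B_\varepsilon(0)}\frac{u(x+Ay)-u(x)}{\varepsilon^2}\,dy+o(1)\qquad\text{as }\varepsilon\to0.$$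
   Context: $S^n(\mathbb{R})$ is the set of real symmetric $n\times n$ matrices and $S^n_+(\mathbb{R})$ the subset of positive semi-definite ones. The bound on $\bigcup\mathbb{A}_x$ may depend on $x$. $F$ being real-valued entails that the sets $\mathcal{A}\in\mathbb{A}_x$ are non-empty. The integrals are well defined for $\varepsilon$ small (depending on $x$). *)

theory Defs
  imports "HOL-Analysis.Analysis" "HOL-Library.Landau_Symbols"
begin

definition sym_mats :: "(real ^ 'n ^ 'n) set" where
  "sym_mats = {M. transpose M = M}"

definition psd_mats :: "(real ^ 'n ^ 'n) set" where
  "psd_mats = {A \<in> sym_mats. \<forall>v. 0 \<le> v \<bullet> (A *v v)}"

definition partial_deriv ::
  "'n::finite \<Rightarrow> (real ^ 'n \<Rightarrow> real) \<Rightarrow> real ^ 'n \<Rightarrow> real" where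
  "partial_deriv i f x = frechet_derivative f (at x) (axis i 1)"

definition hessian :: "(real ^ 'n \<Rightarrow> real) \<Rightarrow> real ^ 'n \<Rightarrow> real ^ 'n ^ 'n" where
  "hessian f x = (\<chi> i j. partial_deriv i (partial_deriv j f) x)"

text \<open>
  Intended for open \<open>S\<close>: there \<open>f\<close> is twice Frechet differentiable with continuous
  second derivative. Values of \<open>f\<close> outside \<open>S\<close> play no role, since derivatives at
  points of \<open>S\<close> only see a neighbourhood inside \<open>S\<close>.
\<close>
definition C2_on :: "(real ^ 'n) set \<Rightarrow> (real ^ 'n \<Rightarrow> real) \<Rightarrow> bool" where
  "C2_on S f \<longleftrightarrow>
     (\<forall>x\<in>S. f differentiable (at x)) \<and>
     (\<forall>j. \<forall>x\<in>S. partial_deriv j f differentiable (at x)) \<and>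
     (\<forall>i j. continuous_on S (partial_deriv i (partial_deriv j f)))"

end

theory Submission imports Defs begin

text \<open>
  Second-order Taylor expansion at \<open>x\<close> with \<open>h = A y\<close>, averaged over \<open>y \<in> B\<^sub>\<epsilon>\<close>: the linear
  term vanishes by symmetry, and since the average of \<open>y\<^sub>i y\<^sub>j\<close> is \<open>\<epsilon>\<^sup>2 / (n + 2)\<close> for \<open>i = j\<close> and
  \<open>0\<close> otherwise, the quadratic term contributes \<open>trace (A\<^sup>t H A) \<epsilon>\<^sup>2 / (2 (n + 2))\<close>. The remainder
  is \<open>o(\<epsilon>\<^sup>2)\<close> uniformly in \<open>A\<close> because the admissible \<open>A\<close> are bounded, so the estimate passes
  through the infimum and the supremum.
\<close>

section \<open>Second-order Taylor expansion\<close>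

lemma frechet_derivative_partial_deriv_sum:
  assumes "f differentiable (at z)"
  shows "frechet_derivative f (at z) v = (\<Sum>j\<in>UNIV. v $ j * partial_deriv j f z)"
proof -
  have lin: "linear (frechet_derivative f (at z))"
    using assms by (rule linear_frechet_derivative)
  have "frechet_derivative f (at z) v = frechet_derivative f (at z) (\<Sum>j\<in>UNIV. v $ j *\<^sub>R axis j 1)"
    by (metis basis_expansion scalar_mult_eq_scaleR)
  also have "\<dots> = (\<Sum>j\<in>UNIV. v $ j * partial_deriv j f z)"
    by (simp add: linear_sum[OF lin] linear_scale[OF lin] partial_deriv_def)
  finally show ?thesis .
qed

text \<open>The estimate is stated with the filter \<open>nhds 0\<close> instead of a radius, so
  that finitely many partial derivatives can be treated at once by
  \<open>eventually_all_finite\<close>.\<close>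

lemma differentiable_expansion:
  fixes f :: "'a::real_normed_vector \<Rightarrow> real"
  assumes "f differentiable (at x)" "e > 0"
  shows "\<forall>\<^sub>F k in nhds 0. \<bar>f (x + k) - f x - frechet_derivative f (at x) k\<bar> \<le> e * norm k"
proof -
  have "(f has_derivative frechet_derivative f (at x)) (at x)"
    using assms frechet_derivative_works by blast
  then obtain d where "d > 0" and d: "\<And>y. norm (y - x) < d \<Longrightarrow>
      norm (f y - f x - frechet_derivative f (at x) (y - x)) \<le> e * norm (y - x)"
    unfolding has_derivative_at_alt using assms(2) by blast
  show ?thesis
    unfolding eventually_nhds_metric
  proof (intro exI[of _ d] conjI allI impI \<open>d > 0\<close>)
    fix k :: 'a assume "dist k 0 < d"
    then show "\<bar>f (x + k) - f x - frechet_derivative f (at x) k\<bar> \<le> e * norm k"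
      using d[of "x + k"] by simp
  qed
qed

text \<open>Each partial derivative of \<open>u\<close> is differentiable at \<open>x\<close>;
  weighting its first-order expansion by \<open>v $ j\<close> and summing over \<open>j\<close>
  gives the claim. The displacement \<open>k\<close> pairs with the outer derivative and
  \<open>v\<close> with the inner one, matching the index order in \<open>hessian\<close>, so the
  formula is available before symmetry is known.\<close>

lemma C2_on_gradient_expansion:
  fixes u :: "real ^ 'n \<Rightarrow> real"
  assumes "open \<Omega>" "C2_on \<Omega> u" "x \<in> \<Omega>" "e > 0"
  obtains d where "d > 0" "ball x d \<subseteq> \<Omega>"
    "\<And>k v. norm k < d \<Longrightarrow>
      \<bar>frechet_derivative u (at (x + k)) v - frechet_derivative u (at x) v - k \<bullet> (hessian u x *v v)\<bar>
        \<le> e * norm k * norm v"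
proof -
  \<comment> \<open>The tolerance \<open>e\<close> is shared equally among the coordinates.\<close>
  define c where "c = e / real CARD('n)"
  have c: "c > 0" using assms by (simp add: c_def)
  have "\<forall>\<^sub>F k in nhds 0. \<bar>partial_deriv j u (x + k) - partial_deriv j u x
      - frechet_derivative (partial_deriv j u) (at x) k\<bar> \<le> c * norm k" for j
    by (rule differentiable_expansion) (use assms c in \<open>auto simp: C2_on_def\<close>)
  then have "\<forall>\<^sub>F k in nhds 0. \<forall>j. \<bar>partial_deriv j u (x + k) - partial_deriv j u x
      - frechet_derivative (partial_deriv j u) (at x) k\<bar> \<le> c * norm k"
    by (rule eventually_all_finite)
  then obtain d1 where d1: "d1 > 0" "\<And>k j. norm k < d1 \<Longrightarrow> \<bar>partial_deriv j u (x + k) - partial_deriv j u x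
      - frechet_derivative (partial_deriv j u) (at x) k\<bar> \<le> c * norm k"
    unfolding eventually_nhds_metric by auto
  obtain d2 where d2: "d2 > 0" "ball x d2 \<subseteq> \<Omega>"
    using assms open_contains_ball by blast
  show thesis
  proof (rule that[of "min d1 d2"])
    show "ball x (min d1 d2) \<subseteq> \<Omega>" using d2 by auto
    fix k v :: "real ^ 'n" assume k: "norm k < min d1 d2"
    then have xk: "x + k \<in> \<Omega>" using d2 by (auto simp: dist_norm subset_iff)
    have hk: "k \<bullet> (hessian u x *v v)
        = (\<Sum>j\<in>UNIV. v $ j * frechet_derivative (partial_deriv j u) (at x) k)"
    proof -
      have "k \<bullet> (hessian u x *v v)
          = (\<Sum>i\<in>UNIV. \<Sum>j\<in>UNIV. v $ j * (k $ i * partial_deriv i (partial_deriv j u) x))"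
        by (simp add: inner_vec_def matrix_vector_mult_def hessian_def sum_distrib_left mult_ac)
      also have "\<dots> = (\<Sum>j\<in>UNIV. \<Sum>i\<in>UNIV. v $ j * (k $ i * partial_deriv i (partial_deriv j u) x))"
        by (rule sum.swap)
      also have "\<dots> = (\<Sum>j\<in>UNIV. v $ j * frechet_derivative (partial_deriv j u) (at x) k)"
        using assms by (subst frechet_derivative_partial_deriv_sum)
          (auto simp: C2_on_def sum_distrib_left)
      finally show ?thesis .
    qed
    have "\<bar>frechet_derivative u (at (x + k)) v - frechet_derivative u (at x) v - k \<bullet> (hessian u x *v v)\<bar>
        = \<bar>\<Sum>j\<in>UNIV. v $ j * (partial_deriv j u (x + k) - partial_deriv j u x
            - frechet_derivative (partial_deriv j u) (at x) k)\<bar>"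
      using assms xk unfolding hk
      by (simp add: C2_on_def frechet_derivative_partial_deriv_sum sum_subtractf right_diff_distrib)
    also have "\<dots> \<le> (\<Sum>j\<in>(UNIV::'n set). norm v * (c * norm k))"
      unfolding real_norm_def[symmetric]
    proof (rule sum_norm_le)
      fix j
      show "norm (v $ j * (partial_deriv j u (x + k) - partial_deriv j u x
            - frechet_derivative (partial_deriv j u) (at x) k)) \<le> norm v * (c * norm k)"
        unfolding norm_mult using k d1(2)[of k j]
        by (intro mult_mono) (auto simp: component_le_norm_cart)
    qed
    also have "\<dots> = e * norm k * norm v" by (simp add: c_def)
    finally show "\<bar>frechet_derivative u (at (x + k)) v - frechet_derivative u (at x) v
        - k \<bullet> (hessian u x *v v)\<bar> \<le> e * norm k * norm v" .
  qed (use d1 d2 in auto)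
qed

lemma has_real_derivative_along_line:
  fixes u :: "'a::real_normed_vector \<Rightarrow> real"
  assumes "u differentiable (at (a + t *\<^sub>R h))"
  shows "((\<lambda>t. u (a + t *\<^sub>R h)) has_real_derivative frechet_derivative u (at (a + t *\<^sub>R h)) h) (at t)"
proof -
  have "(u has_derivative frechet_derivative u (at (a + t *\<^sub>R h))) (at (a + t *\<^sub>R h))"
    using assms frechet_derivative_works by blast
  then have "((\<lambda>t. u (a + t *\<^sub>R h)) has_derivative
      (\<lambda>s. frechet_derivative u (at (a + t *\<^sub>R h)) (s *\<^sub>R h))) (at t)"
    by (rule has_derivative_compose[rotated]) (auto intro!: derivative_eq_intros)
  then show ?thesis
    using linear_scale[OF linear_frechet_derivative[OF assms]]
    by (simp add: has_field_derivative_def mult_commute_abs)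
qed

text \<open>The mean value theorem is applied on \<open>[0, 1]\<close> to
  \<open>u (x + t *\<^sub>R h)\<close> minus its expected quadratic polynomial in \<open>t\<close>.
  The derivative of this difference is exactly the error in the gradient expansion with displacement
  \<open>t *\<^sub>R h\<close> and direction \<open>h\<close>.\<close>

lemma C2_on_taylor2:
  fixes u :: "real ^ 'n \<Rightarrow> real"
  assumes "open \<Omega>" "C2_on \<Omega> u" "x \<in> \<Omega>" "e > 0"
  obtains d where "d > 0" "ball x d \<subseteq> \<Omega>"
    "\<And>h. norm h < d \<Longrightarrow>
      \<bar>u (x + h) - u x - frechet_derivative u (at x) h - (h \<bullet> (hessian u x *v h)) / 2\<bar> \<le> e * (norm h)\<^sup>2"
proof -
  obtain d where d: "d > 0" "ball x d \<subseteq> \<Omega>"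
    "\<And>k v. norm k < d \<Longrightarrow>
      \<bar>frechet_derivative u (at (x + k)) v - frechet_derivative u (at x) v - k \<bullet> (hessian u x *v v)\<bar>
        \<le> e * norm k * norm v"
    using C2_on_gradient_expansion[OF assms] by metis
  show thesis
  proof (rule that[OF d(1,2)])
    fix h :: "real ^ 'n" assume h: "norm h < d"
    define q where "q = h \<bullet> (hessian u x *v h)"
    define p where "p t = u (x + t *\<^sub>R h) - t * frechet_derivative u (at x) h - t\<^sup>2 / 2 * q" for t :: real
    define p' where "p' t = frechet_derivative u (at (x + t *\<^sub>R h)) h - frechet_derivative u (at x) h - t * q"
      for t :: real
    have small: "norm (t *\<^sub>R h) \<le> norm h" if "0 \<le> t" "t \<le> 1" for t :: real
      using that by (simp add: mult_left_le_one_le)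
    have der: "(p has_real_derivative p' t) (at t)" if "0 \<le> t" "t \<le> 1" for t
    proof -
      have "x + t *\<^sub>R h \<in> \<Omega>"
        using small[OF that] h d(2) by (auto simp: subset_iff dist_norm)
      then have "u differentiable (at (x + t *\<^sub>R h))" using assms by (auto simp: C2_on_def)
      from has_real_derivative_along_line[OF this] show ?thesis
        unfolding p_def p'_def by (auto intro!: derivative_eq_intros)
    qed
    obtain t where t: "0 < t" "t < 1" "p 1 - p 0 = p' t"
      using MVT2[of 0 1 p p'] der by auto
    have "\<bar>p' t\<bar> \<le> e * norm (t *\<^sub>R h) * norm h"
      using d(3)[of "t *\<^sub>R h" h] small[of t] t h by (simp add: p'_def q_def)
    also have "\<dots> \<le> e * norm h * norm h"
      using small[of t] t assms(4) by (intro mult_mono) auto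
    finally show "\<bar>u (x + h) - u x - frechet_derivative u (at x) h - (h \<bullet> (hessian u x *v h)) / 2\<bar>
        \<le> e * (norm h)\<^sup>2"
      using t(3) by (simp add: p_def q_def power2_eq_square algebra_simps)
  qed
qed

text \<open>The second difference quotient of \<open>u\<close> is symmetric in \<open>h\<close> and \<open>k\<close>, while the mean value
  theorem along \<open>h\<close> makes it converge to \<open>k \<bullet> (hessian u x *v h)\<close>.\<close>

lemma C2_on_second_difference:
  fixes u :: "real ^ 'n \<Rightarrow> real"
  assumes "open \<Omega>" "C2_on \<Omega> u" "x \<in> \<Omega>"
  shows "((\<lambda>s. (u (x + s *\<^sub>R h + s *\<^sub>R k) - u (x + s *\<^sub>R h) - u (x + s *\<^sub>R k) + u x) / s\<^sup>2)
    \<longlongrightarrow> k \<bullet> (hessian u x *v h)) (at_right 0)"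
proof (rule tendstoI)
  fix r :: real assume "r > 0"
  \<comment> \<open>The summand 1 keeps \<open>N\<close> positive even if \<open>h\<close> and
    \<open>k\<close> vanish. With \<open>e = r / (4 * N\<^sup>2)\<close>, each of the two gradient
    errors below is at most \<open>s\<^sup>2 * (r / 4)\<close>.\<close>
  define N where "N = 1 + norm h + norm k"
  have N: "N \<ge> 1" "norm h \<le> N" "norm k \<le> N" by (auto simp: N_def)
  define e where "e = r / (4 * N\<^sup>2)"
  have e: "e > 0" using \<open>r > 0\<close> N by (simp add: e_def)
  obtain d where d: "d > 0" "ball x d \<subseteq> \<Omega>"
    "\<And>k v. norm k < d \<Longrightarrow>
      \<bar>frechet_derivative u (at (x + k)) v - frechet_derivative u (at x) v - k \<bullet> (hessian u x *v v)\<bar>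
        \<le> e * norm k * norm v"
    using C2_on_gradient_expansion[OF assms e] by metis
  have "\<forall>\<^sub>F s in at_right 0. s < d / N \<and> 0 < s"
    using d N by (intro eventually_conj eventually_at_right_less)
      (auto simp: eventually_at_right_field intro!: exI[of _ "d / N"])
  then show "\<forall>\<^sub>F s in at_right 0. dist ((u (x + s *\<^sub>R h + s *\<^sub>R k) - u (x + s *\<^sub>R h)
    - u (x + s *\<^sub>R k) + u x) / s\<^sup>2) (k \<bullet> (hessian u x *v h)) < r"
  proof (rule eventually_mono)
    fix s assume s: "s < d / N \<and> 0 < s"
    then have sN: "s * N < d" using N by (simp add: field_simps)
    define D where "D y = frechet_derivative u (at (x + y)) (s *\<^sub>R h)" for y
    have small: "norm (t *\<^sub>R s *\<^sub>R h) \<le> s * N" "norm (s *\<^sub>R k + t *\<^sub>R s *\<^sub>R h) \<le> s * N" if "0 \<le> t" "t \<le> 1" for t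
    proof -
      have 1: "norm (t *\<^sub>R s *\<^sub>R h) \<le> s * norm h"
        using that s by (simp add: mult_left_le_one_le)
      have "norm (s *\<^sub>R k + t *\<^sub>R s *\<^sub>R h) \<le> s * norm k + s * norm h"
        using norm_triangle_ineq[of "s *\<^sub>R k" "t *\<^sub>R s *\<^sub>R h"] 1 s by simp
      also have "\<dots> \<le> s * N" using s by (simp add: N_def algebra_simps)
      finally show "norm (s *\<^sub>R k + t *\<^sub>R s *\<^sub>R h) \<le> s * N" .
      show "norm (t *\<^sub>R s *\<^sub>R h) \<le> s * N"
        using 1 N s by (meson mult_left_mono order_trans less_imp_le)
    qed
    \<comment> \<open>The second difference is the increment over \<open>[0, 1]\<close> of this
      function of \<open>t\<close>: the difference of \<open>u\<close> along two parallel segments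
      in direction \<open>h\<close>, shifted against each other by
      \<open>s *\<^sub>R k\<close>.\<close>
    have der: "((\<lambda>t. u ((x + s *\<^sub>R k) + t *\<^sub>R s *\<^sub>R h) - u (x + t *\<^sub>R s *\<^sub>R h)) has_real_derivative
        (D (s *\<^sub>R k + t *\<^sub>R s *\<^sub>R h) - D (t *\<^sub>R s *\<^sub>R h))) (at t)" if "0 \<le> t" "t \<le> 1" for t
    proof -
      have "x + y \<in> \<Omega>" if "norm y \<le> s * N" for y
        using that sN d(2) by (auto simp: subset_iff dist_norm)
      then have *: "u differentiable (at (x + y))" if "norm y \<le> s * N" for y
        using assms that by (auto simp: C2_on_def)
      have "u differentiable (at ((x + s *\<^sub>R k) + t *\<^sub>R s *\<^sub>R h))"
        using *[OF small(2)[OF that]] by (simp add: add.assoc)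
      from DERIV_diff[OF has_real_derivative_along_line[OF this]
          has_real_derivative_along_line[OF *[OF small(1)[OF that]]]]
      show ?thesis unfolding D_def by (simp add: add.assoc)
    qed
    obtain t where t: "0 < t" "t < 1" and mvt:
      "u ((x + s *\<^sub>R k) + s *\<^sub>R h) - u (x + s *\<^sub>R h) - (u (x + s *\<^sub>R k) - u x)
        = D (s *\<^sub>R k + t *\<^sub>R s *\<^sub>R h) - D (t *\<^sub>R s *\<^sub>R h)"
      using MVT2[OF zero_less_one der] by auto
    define E where "E y = D y - D 0 - y \<bullet> (hessian u x *v (s *\<^sub>R h))" for y
    have E: "\<bar>E y\<bar> \<le> s\<^sup>2 * (r / 4)" if "norm y \<le> s * N" for y
    proof -
      have "\<bar>E y\<bar> \<le> e * norm y * norm (s *\<^sub>R h)"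
        using d(3)[of y "s *\<^sub>R h"] that sN by (simp add: E_def D_def)
      also have "\<dots> \<le> e * (s * N) * (s * N)"
        using that e s N by (intro mult_mono) (auto intro!: mult_nonneg_nonneg)
      also have "\<dots> = s\<^sup>2 * (r / 4)" using N by (simp add: e_def power2_eq_square)
      finally show ?thesis .
    qed
    \<comment> \<open>In the difference of the two expansions, \<open>D 0\<close> and the part
      linear in \<open>t *\<^sub>R s *\<^sub>R h\<close> cancel, so the unknown \<open>t\<close>
      survives only in the errors.\<close>
    have "D (s *\<^sub>R k + t *\<^sub>R s *\<^sub>R h) - D (t *\<^sub>R s *\<^sub>R h)
        = s\<^sup>2 * (k \<bullet> (hessian u x *v h)) + (E (s *\<^sub>R k + t *\<^sub>R s *\<^sub>R h) - E (t *\<^sub>R s *\<^sub>R h))"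
      by (simp add: E_def inner_add_left matrix_vector_mult_scaleR power2_eq_square algebra_simps)
    moreover have "\<bar>E (s *\<^sub>R k + t *\<^sub>R s *\<^sub>R h) - E (t *\<^sub>R s *\<^sub>R h)\<bar> \<le> s\<^sup>2 * (r / 2)"
      using E[OF small(1)[of t]] E[OF small(2)[of t]] t by linarith
    moreover have "x + s *\<^sub>R k + s *\<^sub>R h = x + s *\<^sub>R h + s *\<^sub>R k" by simp
    note mvt' = mvt[unfolded this]
    ultimately have "\<bar>(u (x + s *\<^sub>R h + s *\<^sub>R k) - u (x + s *\<^sub>R h) - u (x + s *\<^sub>R k) + u x)
        - s\<^sup>2 * (k \<bullet> (hessian u x *v h))\<bar> \<le> s\<^sup>2 * (r / 2)"
      using mvt' by linarith
    moreover have "\<dots> < s\<^sup>2 * r" using s \<open>r > 0\<close> by simp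
    ultimately have "\<bar>(u (x + s *\<^sub>R h + s *\<^sub>R k) - u (x + s *\<^sub>R h) - u (x + s *\<^sub>R k) + u x)
        - s\<^sup>2 * (k \<bullet> (hessian u x *v h))\<bar> / s\<^sup>2 < r" 
      using s by (simp add: divide_less_eq mult.commute)
    moreover have "\<bar>w - s\<^sup>2 * c\<bar> / s\<^sup>2 = \<bar>w / s\<^sup>2 - c\<bar>" for w c
      using s by (simp add: abs_if field_simps)
    ultimately show "dist ((u (x + s *\<^sub>R h + s *\<^sub>R k) - u (x + s *\<^sub>R h)
    - u (x + s *\<^sub>R k) + u x) / s\<^sup>2) (k \<bullet> (hessian u x *v h)) < r"
      by (simp add: dist_real_def)
  qed
qed

text \<open>The formula for \<open>F\<close> is available only on \<open>sym_mats\<close>, so this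
  is what permits evaluating \<open>F\<close> at the Hessian. Exchanging \<open>h\<close> and
  \<open>k\<close> leaves the second difference unchanged, and limits are unique.\<close>

lemma hessian_symmetric:
  fixes u :: "real ^ 'n \<Rightarrow> real"
  assumes "open \<Omega>" "C2_on \<Omega> u" "x \<in> \<Omega>"
  shows "hessian u x \<in> sym_mats"
proof -
  have eq: "k \<bullet> (hessian u x *v h) = h \<bullet> (hessian u x *v k)" for h k
  proof (rule tendsto_unique[OF _ C2_on_second_difference[OF assms]])
    show "((\<lambda>s. (u (x + s *\<^sub>R h + s *\<^sub>R k) - u (x + s *\<^sub>R h) - u (x + s *\<^sub>R k) + u x) / s\<^sup>2)
      \<longlongrightarrow> h \<bullet> (hessian u x *v k)) (at_right 0)"
      using C2_on_second_difference[OF assms, of k h] by (simp add: algebra_simps)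
  qed simp
  have "hessian u x $ i $ j = axis i 1 \<bullet> (hessian u x *v axis j 1)" for i j
    by (simp add: inner_axis' matrix_vector_mult_basis column_def)
  then show ?thesis
    unfolding sym_mats_def transpose_def by (simp add: vec_eq_iff eq)
qed

section \<open>Second moments of the ball\<close>

lemma prod_Basis_cart:
  fixes f :: "real ^ 'n \<Rightarrow> 'b::comm_monoid_mult"
  shows "(\<Prod>b\<in>Basis. f b) = (\<Prod>i\<in>UNIV. f (axis i 1))"
proof -
  have "(Basis :: (real^'n) set) = range (\<lambda>i. axis i 1)"
    by (auto simp: Basis_vec_def)
  then have "(\<Prod>b\<in>Basis. f b) = prod f (range (\<lambda>i. axis i 1))"
    by (rule arg_cong)
  also have "\<dots> = (\<Prod>i\<in>UNIV. f (axis i 1))"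
    by (subst prod.reindex) (auto simp: axis_eq_axis inj_def)
  finally show ?thesis .
qed

text \<open>Lebesgue measure is determined by its values on boxes. The preimage of a box under a
  coordinate swap is a box with the same side lengths in another order, hence of the same
  volume.\<close>

lemma lborel_distr_transpose:
  "distr lborel borel (\<lambda>y::real^'n. \<chi> l. y $ Transposition.transpose i j l) = lborel"
proof (rule lborel_eqI[symmetric])
  let ?t = "Transposition.transpose i j"
  let ?P = "\<lambda>y::real^'n. \<chi> l. y $ ?t l"
  have [measurable]: "?P \<in> borel_measurable borel"
    by (intro borel_measurable_continuous_onI continuous_intros)
  fix l u :: "real ^ 'n" assume le: "\<And>b. b \<in> Basis \<Longrightarrow> l \<bullet> b \<le> u \<bullet> b"
  have le': "l $ k \<le> u $ k" for k
    using le[of "axis k 1"] by (simp add: inner_axis axis_in_Basis_iff)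
  have "?P -` box l u = box (?P l) (?P u)"
    by (auto simp: mem_box_cart; metis transpose_involutory)
  then have "emeasure (distr lborel borel ?P) (box l u) = emeasure lborel (box (?P l) (?P u))"
    by (simp add: emeasure_distr)
  also have "\<dots> = (\<Prod>b\<in>Basis. (?P u - ?P l) \<bullet> b)"
    using le' by (intro emeasure_lborel_box) (auto simp: Basis_vec_def inner_axis)
  also have "(\<Prod>b\<in>Basis. (?P u - ?P l) \<bullet> b) = (\<Prod>k\<in>UNIV. (u - l) $ ?t k)"
    by (simp add: inner_axis prod_Basis_cart)
  also have "(\<Prod>k\<in>UNIV. (u - l) $ ?t k) = (\<Prod>k\<in>UNIV. (u - l) $ k)"
    by (rule prod.reindex_bij_betw[OF bij_transpose])
  also have "\<dots> = (\<Prod>b\<in>Basis. (u - l) \<bullet> b)"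
    by (simp add: prod_Basis_cart inner_axis)
  finally show "emeasure (distr lborel borel ?P) (box l u) = (\<Prod>b\<in>Basis. (u - l) \<bullet> b)" .
qed simp

text \<open>The reflection is a diagonal map with entries 1 and -1, so the product of their absolute
  values, which is the density in the change of variables, equals 1.\<close>

lemma lborel_distr_reflect:
  "distr lborel borel (\<lambda>y::real^'n. \<chi> l. if l = i then - y $ l else y $ l) = lborel"
proof -
  define c where "c b = (if b = axis i 1 then - 1 else 1 :: real)" for b :: "real ^ 'n"
  let ?T = "\<lambda>y::real^'n. 0 + (\<Sum>b\<in>Basis. (c b * (y \<bullet> b)) *\<^sub>R b)"
  have c: "\<bar>c b\<bar> = 1" for b by (simp add: c_def)
  have T: "?T = (\<lambda>y::real^'n. \<chi> l. if l = i then - y $ l else y $ l)"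
  proof
    fix y :: "real ^ 'n"
    show "?T y = (\<chi> l. if l = i then - y $ l else y $ l)"
    proof (rule euclidean_eqI)
      fix b :: "real ^ 'n" assume b: "b \<in> Basis"
      then obtain l where l: "b = axis l 1" by (auto simp: Basis_vec_def)
      have "?T y \<bullet> b = c b * (y \<bullet> b)"
        using b by (simp add: inner_sum_left inner_Basis if_distrib cong: if_cong)
      then show "?T y \<bullet> b = (\<chi> l. if l = i then - y $ l else y $ l) \<bullet> b"
        by (simp add: l inner_axis c_def axis_eq_axis)
    qed
  qed
  have "lborel = density (distr lborel borel ?T) (\<lambda>_. (\<Prod>b\<in>Basis. \<bar>c b\<bar>))"
    by (rule lborel_affine_euclidean) (use c in \<open>auto simp: c_def\<close>)
  then show ?thesis unfolding T by (simp add: c density_1)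
qed

text \<open>A norm-preserving map leaves the indicator of a centred ball unchanged, so only the
  integrand changes under the substitution. It is applied below to point reflection, sign change of
  one coordinate, and a swap of two coordinates.\<close>

lemma set_integral_ball_invariant:
  fixes g :: "real ^ 'n \<Rightarrow> real"
  assumes "distr lborel borel T = lborel" "T \<in> borel_measurable borel"
    "\<And>y. norm (T y) = norm y" "g \<in> borel_measurable borel"
  shows "(LINT y : ball 0 r | lborel. g (T y)) = (LINT y : ball 0 r | lborel. g y)"
proof -
  have "(LINT y : ball 0 r | lborel. g y) = (LINT y | distr lborel borel T. indicator (ball 0 r) y *\<^sub>R g y)"
    by (simp add: assms(1) set_lebesgue_integral_def)
  also have "\<dots> = (LINT y | lborel. indicator (ball 0 r) (T y) *\<^sub>R g (T y))"
    using assms(2,4) by (subst integral_distr) (auto intro!: borel_measurable_times borel_measurable_indicator)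
  also have "\<dots> = (LINT y : ball 0 r | lborel. g (T y))"
    by (simp add: set_lebesgue_integral_def indicator_def assms(3))
  finally show ?thesis by simp
qed

section \<open>Integrals of linear and quadratic functions over a ball\<close>

lemma set_integrable_ball_continuous:
  fixes g :: "'a::euclidean_space \<Rightarrow> real"
  assumes "continuous_on (cball 0 r) g"
  shows "set_integrable lborel (ball 0 r) g"
proof (rule set_integrable_subset)
  show "set_integrable lborel (cball 0 r) g"
    unfolding set_integrable_def by (rule borel_integrable_compact) (use assms in auto)
qed auto

lemma set_integral_sum:
  fixes f :: "'i \<Rightarrow> 'a \<Rightarrow> real"
  assumes "\<And>i. i \<in> I \<Longrightarrow> set_integrable M A (f i)"
  shows "(LINT x : A | M. (\<Sum>i\<in>I. f i x)) = (\<Sum>i\<in>I. (LINT x : A | M. f i x))"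
  using assms unfolding set_lebesgue_integral_def set_integrable_def scaleR_sum_right
  by (rule Bochner_Integration.integral_sum)

text \<open>The substitution of \<open>- y\<close> for \<open>y\<close> shows that the integral
  equals its own negative.\<close>

lemma first_moment_ball:
  fixes T :: "real ^ 'n \<Rightarrow> real"
  assumes "linear T"
  shows "(LINT y : ball 0 r | lborel. T y) = 0"
proof -
  have "T \<in> borel_measurable borel"
    using assms by (intro borel_measurable_continuous_onI linear_continuous_on) (simp add: linear_conv_bounded_linear)
  moreover have "distr lborel borel (uminus :: real ^ 'n \<Rightarrow> _) = lborel"
    by (subst (2) lborel_affine[of "-1" 0]) (auto simp: density_1)
  ultimately have "(LINT y : ball 0 r | lborel. T (- y)) = (LINT y : ball 0 r | lborel. T y)"
    by (intro set_integral_ball_invariant) auto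
  then show ?thesis
    by (simp add: linear_neg[OF assms] set_lebesgue_integral_def)
qed

text \<open>Changing the sign of the \<open>i\<close>-th coordinate alone negates the integrand,
  because \<open>j\<close> differs from \<open>i\<close>.\<close>

lemma mixed_moment_ball:
  assumes "i \<noteq> j"
  shows "(LINT y : ball 0 r | lborel. (y::real^'n) $ i * y $ j) = 0"
proof -
  let ?T = "\<lambda>y::real^'n. \<chi> l. if l = i then - y $ l else y $ l"
  \<comment> \<open>This form without a case distinction makes continuity, and hence measurability,
    immediate.\<close>
  have eq: "?T = (\<lambda>y. y - (2 * y $ i) *\<^sub>R axis i 1)"
    by (auto simp: fun_eq_iff vec_eq_iff axis_def)
  have "?T \<in> borel_measurable borel" unfolding eq
    by (intro borel_measurable_continuous_onI continuous_intros)
  moreover have "(\<lambda>y::real^'n. y $ i * y $ j) \<in> borel_measurable borel"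
    by (intro borel_measurable_continuous_onI continuous_intros)
  moreover have "norm (?T y) = norm y" for y
    by (auto simp: norm_vec_def L2_set_def intro!: arg_cong[of _ _ sqrt] sum.cong)
  ultimately have "(LINT y : ball 0 r | lborel. ?T y $ i * ?T y $ j)
      = (LINT y : ball 0 r | lborel. (y::real^'n) $ i * y $ j)"
    by (intro set_integral_ball_invariant lborel_distr_reflect)
  then show ?thesis using assms by (simp add: set_lebesgue_integral_def)
qed

lemma square_moment_ball_eq:
  "(LINT y : ball 0 r | lborel. ((y::real^'n) $ i)\<^sup>2) = (LINT y : ball 0 r | lborel. ((y::real^'n) $ j)\<^sup>2)"
proof -
  let ?T = "\<lambda>y::real^'n. \<chi> l. y $ Transposition.transpose i j l"
  have "?T \<in> borel_measurable borel"
    by (intro borel_measurable_continuous_onI continuous_intros)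
  moreover have "(\<lambda>y::real^'n. (y $ j)\<^sup>2) \<in> borel_measurable borel"
    by (intro borel_measurable_continuous_onI continuous_intros)
  moreover have "norm (?T y) = norm y" for y
    unfolding norm_vec_def L2_set_def
    using sum.reindex_bij_betw[OF bij_transpose[of i j], of "\<lambda>k. (norm (y $ k))\<^sup>2"] by simp
  ultimately have "(LINT y : ball 0 r | lborel. (?T y $ j)\<^sup>2) = (LINT y : ball 0 r | lborel. ((y::real^'n) $ j)\<^sup>2)"
    by (intro set_integral_ball_invariant lborel_distr_transpose)
  then show ?thesis by simp
qed

text \<open>Under the substitution of \<open>c *\<^sub>R y\<close> for \<open>y\<close>, the volume
  contributes \<open>c ^ DIM('a)\<close> and the integrand a further
  \<open>c\<^sup>2\<close>.\<close>

lemma norm_square_moment_scale: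
  assumes "c > 0"
  shows "(LINT y : ball 0 (c * r) | lborel. (norm (y::'a::euclidean_space))\<^sup>2)
    = c ^ (DIM('a) + 2) * (LINT y : ball 0 r | lborel. (norm (y::'a))\<^sup>2)"
proof -
  let ?g = "\<lambda>y::'a. indicator (ball 0 (c * r)) y * (norm y)\<^sup>2"
  have [measurable]: "?g \<in> borel_measurable borel"
    by (intro borel_measurable_times borel_measurable_indicator) auto
  let ?D = "distr lborel borel (\<lambda>y::'a. 0 + c *\<^sub>R y)"
  have "(LINT y | lborel. ?g y) = (LINT y | density ?D (\<lambda>_. ennreal (\<bar>c\<bar> ^ DIM('a))). ?g y)"
    using lborel_affine[of c "0::'a"] assms by simp
  also have "\<dots> = (LINT y | ?D. c ^ DIM('a) * ?g y)"
    using assms by (subst integral_density) auto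
  also have "\<dots> = (LINT y | lborel. c ^ DIM('a) * ?g (c *\<^sub>R y))"
    by (subst integral_distr) auto
  also have "\<dots> = (LINT y | lborel. c ^ (DIM('a) + 2) * (indicator (ball 0 r) y * (norm (y::'a))\<^sup>2))"
    using assms by (intro Bochner_Integration.integral_cong) (auto simp: indicator_def power_add power2_eq_square)
  finally show ?thesis by (simp add: set_lebesgue_integral_def)
qed

text \<open>Comparing \<open>(norm y)\<^sup>2\<close> with its extreme values on the annulus between radii \<open>c * r\<close> and
  \<open>r\<close>, and letting \<open>c\<close> tend to \<open>1\<close>, determines the moment from its scaling law.\<close>

lemma norm_square_moment_ball:
  assumes "r > 0"
  shows "(LINT y : ball 0 r | lborel. (norm (y::'a::euclidean_space))\<^sup>2)
    = real DIM('a) / (real DIM('a) + 2) * r\<^sup>2 * measure lborel (ball (0::'a) r)"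
proof -
  define n where "n = DIM('a)"
  define V where "V = measure lborel (ball (0::'a) r)"
  define I where "I = (LINT y : ball 0 r | lborel. (norm (y::'a))\<^sup>2)"
  have int: "set_integrable lborel (ball 0 s) (\<lambda>y::'a. (norm y)\<^sup>2)" for s
    by (intro set_integrable_ball_continuous continuous_intros)
  \<comment> \<open>The annulus has volume \<open>(1 - c ^ n) * V\<close> and moment
    \<open>(1 - c ^ (n + 2)) * I\<close>. Cancelling the common factor \<open>1 - c\<close> leaves
    geometric sums, which tend to \<open>n\<close> and \<open>n + 2\<close> as \<open>c\<close>
    tends to 1.\<close>
  have bounds: "c\<^sup>2 * r\<^sup>2 * (\<Sum>k<n. c ^ k) * V \<le> (\<Sum>k<n+2. c ^ k) * I
      \<and> (\<Sum>k<n+2. c ^ k) * I \<le> r\<^sup>2 * (\<Sum>k<n. c ^ k) * V" if c: "0 < c" "c < 1" for c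
  proof -
    let ?R = "ball (0::'a) r - ball 0 (c * r)"
    have cr: "c * r < r" using c assms by simp
    have sub: "ball (0::'a) (c * r) \<subseteq> ball 0 r" using cr by auto
    have fin: "emeasure lborel ?R < \<infinity>"
      using emeasure_mono[of ?R "ball (0::'a) r" lborel] emeasure_bounded_finite[of "ball (0::'a) r"]
      by (auto simp: less_top[symmetric] top_unique)
    have mR: "measure lborel ?R = (1 - c ^ n) * V"
    proof -
      have "measure lborel ?R = V - measure lborel (ball (0::'a) (c * r))"
        unfolding V_def using sub emeasure_bounded_finite[of "ball (0::'a) r"]
        by (intro measure_Diff) (auto simp: less_top[symmetric])
      also have "measure lborel (ball (0::'a) (c * r)) = c ^ n * V"
        using assms c by (simp add: V_def n_def content_ball power_mult_distrib)
      finally show ?thesis by (simp add: algebra_simps)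
    qed
    have intR: "set_integrable lborel ?R (\<lambda>y::'a. (norm y)\<^sup>2)"
      by (rule set_integrable_subset[OF int[of r]]) auto
    have const: "set_integrable lborel ?R (\<lambda>_. q::real)" "(LINT y:?R|lborel. q) = (1 - c ^ n) * V * q" for q
      using fin by (auto simp: set_integrable_def set_lebesgue_integral_def mR)
    have IR: "(LINT y : ?R | lborel. (norm y)\<^sup>2) = (1 - c ^ (n + 2)) * I"
    proof -
      have "ball 0 (c * r) \<union> ?R = ball 0 r" using sub by auto
      then have "I = (LINT y : ball 0 (c * r) \<union> ?R | lborel. (norm (y::'a))\<^sup>2)"
        by (simp add: I_def)
      also have "\<dots> = (LINT y : ball 0 (c * r) | lborel. (norm (y::'a))\<^sup>2) + (LINT y : ?R | lborel. (norm y)\<^sup>2)"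
        by (intro set_integral_Un int intR) auto
      also have "(LINT y : ball 0 (c * r) | lborel. (norm (y::'a))\<^sup>2) = c ^ (n + 2) * I"
        using c norm_square_moment_scale[of c r] by (simp add: n_def I_def)
      finally show ?thesis by (simp add: algebra_simps)
    qed
    have "(1 - c ^ n) * V * (c\<^sup>2 * r\<^sup>2) \<le> (1 - c ^ (n + 2)) * I"
      unfolding IR[symmetric] const(2)[symmetric]
    proof (rule set_integral_mono[OF const(1) intR])
      fix y assume "y \<in> ?R"
      then have "c * r \<le> norm y" by simp
      then show "c\<^sup>2 * r\<^sup>2 \<le> (norm y)\<^sup>2"
        using c assms unfolding power_mult_distrib[symmetric] by (intro power_mono) auto
    qed
    moreover have "(1 - c ^ (n + 2)) * I \<le> (1 - c ^ n) * V * r\<^sup>2"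
      unfolding IR[symmetric] const(2)[symmetric]
      by (rule set_integral_mono[OF intR const(1)]) (auto intro!: power_mono)
    ultimately have "(1 - c) * (c\<^sup>2 * r\<^sup>2 * (\<Sum>k<n. c ^ k) * V) \<le> (1 - c) * ((\<Sum>k<n+2. c ^ k) * I)"
      "(1 - c) * ((\<Sum>k<n+2. c ^ k) * I) \<le> (1 - c) * (r\<^sup>2 * (\<Sum>k<n. c ^ k) * V)"
      unfolding one_diff_power_eq[of c] by (simp_all add: mult_ac)
    then show ?thesis using c by (simp add: mult_le_cancel_left_pos)
  qed
  have ev: "\<forall>\<^sub>F c in at_left (1::real). 0 < c \<and> c < 1"
    by (auto simp: eventually_at_left_field intro!: exI[of _ 0])
  have lim: "((\<lambda>c. \<Sum>k<m. c ^ k) \<longlongrightarrow> real m) (at_left (1::real))" for m :: nat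
    by (rule tendsto_eq_intros refl | simp)+
  have lims: "((\<lambda>c. c\<^sup>2 * r\<^sup>2 * (\<Sum>k<n. c ^ k) * V) \<longlongrightarrow> r\<^sup>2 * real n * V) (at_left 1)"
    "((\<lambda>c. (\<Sum>k<n+2. c ^ k) * I) \<longlongrightarrow> real (n + 2) * I) (at_left 1)"
    "((\<lambda>c. r\<^sup>2 * (\<Sum>k<n. c ^ k) * V) \<longlongrightarrow> r\<^sup>2 * real n * V) (at_left 1)"
    by (rule tendsto_eq_intros lim refl | simp)+
  \<comment> \<open>Both outer bounds have the same limit, so the two limiting inequalities combine
    into an equation for \<open>I\<close>.\<close>
  have "r\<^sup>2 * real n * V \<le> real (n + 2) * I"
    by (rule tendsto_le[OF _ lims(2) lims(1)]) (use ev bounds in \<open>auto elim: eventually_mono\<close>)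
  moreover have "real (n + 2) * I \<le> r\<^sup>2 * real n * V"
    by (rule tendsto_le[OF _ lims(3) lims(2)]) (use ev bounds in \<open>auto elim: eventually_mono\<close>)
  ultimately have "real (n + 2) * I = r\<^sup>2 * real n * V" by simp
  then show ?thesis
    unfolding I_def[symmetric] V_def[symmetric] n_def[symmetric]
    by (simp add: field_simps)
qed

text \<open>The moment of the squared norm is the sum of the coordinate moments, all equal by the
  swap symmetry, so each is the total divided by the dimension.\<close>

lemma square_moment_ball:
  assumes "r > 0"
  shows "(LINT y : ball 0 r | lborel. ((y::real^'n) $ i)\<^sup>2)
    = r\<^sup>2 / (real CARD('n) + 2) * measure lborel (ball (0::real^'n) r)"
proof -
  have "(LINT y : ball 0 r | lborel. (norm (y::real^'n))\<^sup>2) = (LINT y : ball 0 r | lborel. (\<Sum>j\<in>UNIV. ((y::real^'n) $ j)\<^sup>2))"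
    by (simp add: norm_vec_def L2_set_def sum_nonneg)
  also have "\<dots> = (\<Sum>j\<in>UNIV. (LINT y : ball 0 r | lborel. ((y::real^'n) $ j)\<^sup>2))"
    by (intro set_integral_sum set_integrable_ball_continuous continuous_intros)
  also have "\<dots> = (\<Sum>j\<in>(UNIV::'n set). (LINT y : ball 0 r | lborel. ((y::real^'n) $ i)\<^sup>2))"
    by (intro sum.cong refl square_moment_ball_eq)
  finally have "real CARD('n) * (LINT y : ball 0 r | lborel. ((y::real^'n) $ i)\<^sup>2)
      = real CARD('n) * (r\<^sup>2 / (real CARD('n) + 2) * measure lborel (ball (0::real^'n) r))"
    using norm_square_moment_ball[OF assms, where 'a = "real^'n"] by simp
  then show ?thesis by (subst (asm) mult_cancel_left) simp
qed

text \<open>After expansion into monomials the mixed moments vanish, and the diagonal entries of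
  \<open>M\<close> share one common factor.\<close>

lemma quadratic_form_integral_ball:
  fixes M :: "real ^ 'n ^ 'n"
  assumes "r > 0"
  shows "(LINT y : ball 0 r | lborel. y \<bullet> (M *v y))
    = trace M * (r\<^sup>2 / (real CARD('n) + 2) * measure lborel (ball (0::real^'n) r))"
proof -
  let ?m = "r\<^sup>2 / (real CARD('n) + 2) * measure lborel (ball (0::real^'n) r)"
  have moment: "(LINT y : ball 0 r | lborel. (y::real^'n) $ i * y $ j) = (if i = j then ?m else 0)" for i j
    using mixed_moment_ball[of i j r] square_moment_ball[OF assms, of i] by (auto simp: power2_eq_square)
  have "(LINT y : ball 0 r | lborel. y \<bullet> (M *v y))
      = (LINT y : ball 0 r | lborel. (\<Sum>i\<in>UNIV. \<Sum>j\<in>UNIV. M $ i $ j * (y $ i * y $ j)))"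
    by (simp add: inner_vec_def matrix_vector_mult_def sum_distrib_left mult_ac)
  also have "\<dots> = (\<Sum>i\<in>UNIV. (LINT y : ball 0 r | lborel. (\<Sum>j\<in>UNIV. M $ i $ j * (y $ i * y $ j))))"
    by (intro set_integral_sum set_integrable_ball_continuous continuous_intros)
  also have "\<dots> = (\<Sum>i\<in>UNIV. \<Sum>j\<in>UNIV. (LINT y : ball 0 r | lborel. M $ i $ j * (y $ i * y $ j)))"
    by (intro sum.cong refl set_integral_sum set_integrable_ball_continuous continuous_intros)
  also have "\<dots> = (\<Sum>i\<in>UNIV. \<Sum>j\<in>UNIV. if i = j then M $ i $ i * ?m else 0)"
    by (intro sum.cong refl) (auto simp: moment)
  also have "\<dots> = trace M * ?m"
    by (simp add: trace_def sum_distrib_right sum_divide_distrib)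
  finally show ?thesis .
qed

section \<open>The asymptotic mean value formula\<close>

text \<open>The moments are computed for \<open>lborel\<close>, whereas the theorem integrates over
  its completion \<open>lebesgue\<close>; Borel measurable integrands do not see the
  difference.\<close>

lemma set_integral_lebesgue_eq_lborel:
  fixes f :: "'a::euclidean_space \<Rightarrow> real"
  assumes "set_integrable lborel S f"
  shows "(LINT y : S | lebesgue. f y) = (LINT y : S | lborel. f y)"
  using assms unfolding set_lebesgue_integral_def set_integrable_def
  by (intro integral_completion borel_measurable_integrable)

text \<open>A crude entrywise bound suffices: what matters is that the constant depends on
  \<open>A\<close> only through the bound \<open>B\<close>.\<close>

lemma norm_matrix_vector_mult_le:
  fixes A :: "real ^ 'n ^ 'm"
  assumes "norm A \<le> B"
  shows "norm (A *v y) \<le> real CARD('m) * real CARD('n) * B * norm y"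
proof -
  have "\<bar>A $ i $ j\<bar> \<le> B" for i j
    using component_le_norm_cart[of "A $ i" j] Finite_Cartesian_Product.norm_nth_le[of A i] assms by linarith
  then have "onorm ((*v) A) \<le> real CARD('m) * real CARD('n) * B"
    by (rule onorm_le_matrix_component)
  moreover have "norm (A *v y) \<le> onorm ((*v) A) * norm y"
    by (rule onorm) simp
  ultimately show ?thesis
    by (meson mult_right_mono norm_ge_zero order_trans)
qed

text \<open>The Taylor estimate is integrated with \<open>h = A *v y\<close>. The final error
  involves \<open>A\<close> only through \<open>K\<close>, which yields uniformity over a bounded
  family of matrices.\<close>

lemma ball_average_expansion:
  fixes A H :: "real ^ 'n ^ 'n"
  assumes r: "r > 0" and e: "e \<ge> 0" and K: "\<And>y. norm (A *v y) \<le> K * norm y" "K > 0" "K * r < d"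
    and u: "continuous_on (ball x d) u" and L: "linear L"
    and taylor: "\<And>h. norm h < d \<Longrightarrow>
      \<bar>u (x + h) - u x - L h - (h \<bullet> (H *v h)) / 2\<bar> \<le> e * (norm h)\<^sup>2"
  shows "\<bar>trace (transpose A ** H ** A) - 2 * (real CARD('n) + 2) *
      (1 / measure lebesgue (ball (0 :: real ^ 'n) r) *
        (LINT y : ball 0 r | lebesgue. (u (x + A *v y) - u x) / r\<^sup>2))\<bar>
    \<le> 2 * (real CARD('n) + 2) * e * K\<^sup>2"
proof -
  define V where "V = measure lborel (ball (0 :: real ^ 'n) r)"
  have V: "V > 0" using r by (simp add: V_def)
  define M where "M = transpose A ** H ** A"
  define m where "m = 2 * (real CARD('n) + 2)"
  have m: "m > 0" by (simp add: m_def add_pos_pos)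
  have m2: "real CARD('n) + 2 = m / 2" by (simp add: m_def)
  define w where "w y = u (x + A *v y) - u x" for y
  define R where "R y = w y - L (A *v y) - (y \<bullet> (M *v y)) / 2" for y
  have small: "norm (A *v y) \<le> K * r" if "norm y \<le> r" for y
    using K(1)[of y] mult_left_mono[OF that, of K] K(2) by linarith
  \<comment> \<open>The quadratic Taylor term in \<open>A *v y\<close> is a quadratic form in
    \<open>y\<close> with matrix \<open>M\<close>, so its integral is governed by
    \<open>trace M\<close>.\<close>
  have M: "y \<bullet> (M *v y) = (A *v y) \<bullet> (H *v (A *v y))" for y
  proof -
    have "M *v y = transpose A *v (H *v (A *v y))"
      by (simp add: M_def matrix_vector_mul_assoc matrix_mul_assoc)
    then show ?thesis
      by (metis dot_lmul_matrix inner_commute transpose_matrix_vector)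
  qed
  have linLA: "linear (\<lambda>y. L (A *v y))"
    using linear_compose[OF matrix_vector_mul_linear[of A] L] by (simp add: o_def)
  have int_w: "set_integrable lborel (ball 0 r) w"
    unfolding w_def
  proof (intro set_integrable_ball_continuous continuous_on_diff continuous_on_const)
    show "continuous_on (cball 0 r) (\<lambda>y. u (x + A *v y))"
    proof (rule continuous_on_compose2[OF u])
      show "continuous_on (cball 0 r) (\<lambda>y. x + A *v y)"
        by (intro continuous_intros linear_continuous_on matrix_vector_mul_bounded_linear)
      show "(\<lambda>y. x + A *v y) ` cball 0 r \<subseteq> ball x d"
        using small K(3) by (force simp: dist_norm)
    qed
  qed
  have int_L: "set_integrable lborel (ball 0 r) (\<lambda>y. L (A *v y))"
    using linLA by (intro set_integrable_ball_continuous linear_continuous_on)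
      (simp add: linear_conv_bounded_linear)
  have int_M: "set_integrable lborel (ball 0 r) (\<lambda>y. (y \<bullet> (M *v y)) / 2)"
    by (intro set_integrable_ball_continuous continuous_intros linear_continuous_on
        matrix_vector_mul_bounded_linear) auto
  have int_R: "set_integrable lborel (ball 0 r) R"
    unfolding R_def by (intro set_integral_diff int_w int_L int_M)
  have "(LINT y : ball 0 r | lborel. R y) = (LINT y : ball 0 r | lborel. w y)
      - (LINT y : ball 0 r | lborel. L (A *v y)) - (LINT y : ball 0 r | lborel. (y \<bullet> (M *v y)) / 2)"
    unfolding R_def by (simp add: set_integral_diff int_w int_L int_M)
  also have "(LINT y : ball 0 r | lborel. L (A *v y)) = 0"
    by (rule first_moment_ball[OF linLA])
  also have "(LINT y : ball 0 r | lborel. (y \<bullet> (M *v y)) / 2) = trace M * r\<^sup>2 * V / m"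
    using quadratic_form_integral_ball[OF r, of M] by (simp add: V_def m2)
  finally have LR: "(LINT y : ball 0 r | lborel. R y)
      = (LINT y : ball 0 r | lborel. w y) - trace M * r\<^sup>2 * V / m" by simp
  have "\<bar>LINT y : ball 0 r | lborel. R y\<bar> \<le> (LINT y : ball 0 r | lborel. \<bar>R y\<bar>)"
    using set_integral_norm_bound[OF int_R] by simp
  also have "\<dots> \<le> (LINT y : ball (0 :: real ^ 'n) r | lborel. e * (K * r)\<^sup>2)"
  proof (rule set_integral_mono)
    show "set_integrable lborel (ball 0 r) (\<lambda>y. \<bar>R y\<bar>)"
      using set_integrable_norm[OF int_R] by simp
    show "set_integrable lborel (ball (0 :: real ^ 'n) r) (\<lambda>y. e * (K * r)\<^sup>2)"
      by (intro set_integrable_ball_continuous continuous_intros)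
    fix y :: "real ^ 'n" assume "y \<in> ball 0 r"
    then have y: "norm (A *v y) \<le> K * r" by (intro small) simp
    then have "\<bar>R y\<bar> \<le> e * (norm (A *v y))\<^sup>2"
      using taylor[of "A *v y"] K(3) by (simp add: R_def w_def M)
    also have "\<dots> \<le> e * (K * r)\<^sup>2"
      using y e by (intro mult_left_mono power_mono) auto
    finally show "\<bar>R y\<bar> \<le> e * (K * r)\<^sup>2" .
  qed
  also have "\<dots> = e * (K * r)\<^sup>2 * V"
    by (simp add: set_lebesgue_integral_def V_def)
  finally have "\<bar>trace M * r\<^sup>2 * V / m - (LINT y : ball 0 r | lborel. w y)\<bar> \<le> e * (K * r)\<^sup>2 * V"
    unfolding LR by linarith
  \<comment> \<open>The factor \<open>m / (r\<^sup>2 * V)\<close> turns the integral of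
    \<open>w\<close> into the normalised average and the main term into
    \<open>trace M\<close>.\<close>
  then have "m / (r\<^sup>2 * V) * \<bar>trace M * r\<^sup>2 * V / m - (LINT y : ball 0 r | lborel. w y)\<bar>
      \<le> m / (r\<^sup>2 * V) * (e * (K * r)\<^sup>2 * V)"
    using m V r by (intro mult_left_mono) auto
  also have "m / (r\<^sup>2 * V) * \<bar>trace M * r\<^sup>2 * V / m - (LINT y : ball 0 r | lborel. w y)\<bar>
      = \<bar>m / (r\<^sup>2 * V) * (trace M * r\<^sup>2 * V / m - (LINT y : ball 0 r | lborel. w y))\<bar>"
    using m V r by (simp add: abs_mult)
  also have "m / (r\<^sup>2 * V) * (trace M * r\<^sup>2 * V / m - (LINT y : ball 0 r | lborel. w y))
      = trace M - m * (1 / V * ((LINT y : ball 0 r | lborel. w y) / r\<^sup>2))"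
    using m V r by (simp add: field_simps)
  also have "m / (r\<^sup>2 * V) * (e * (K * r)\<^sup>2 * V) = m * e * K\<^sup>2"
    using V r by (simp add: power_mult_distrib)
  also have "(LINT y : ball 0 r | lborel. w y) / r\<^sup>2 = (LINT y : ball 0 r | lebesgue. w y / r\<^sup>2)"
    using set_integral_lebesgue_eq_lborel[OF int_w] by simp
  finally show ?thesis
    by (simp add: M_def m_def V_def w_def)
qed

section \<open>Comparison of sup-inf expressions\<close>

text \<open>Suprema and infima of reals behave well only for bounded non-empty families;
  \<open>B\<close> and \<open>C\<close> supply the bounds. The affine form with \<open>k > 0\<close>
  allows use in both directions, with \<open>k\<close> and with \<open>1 / k\<close>.\<close>

lemma SUP_INF_le_affine:
  fixes f g :: "'a \<Rightarrow> real"
  assumes ne: "\<AA> \<noteq> {}" "\<And>\<A>. \<A> \<in> \<AA> \<Longrightarrow> \<A> \<noteq> {}" and k: "k > 0"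
    and le: "\<And>A. A \<in> \<Union>\<AA> \<Longrightarrow> f A \<le> k * g A + c"
    and f: "\<And>A. A \<in> \<Union>\<AA> \<Longrightarrow> \<bar>f A\<bar> \<le> B" and g: "\<And>A. A \<in> \<Union>\<AA> \<Longrightarrow> \<bar>g A\<bar> \<le> C"
  shows "(SUP \<A>\<in>\<AA>. INF A\<in>\<A>. f A) \<le> k * (SUP \<A>\<in>\<AA>. INF A\<in>\<A>. g A) + c"
proof (rule cSUP_least[OF ne(1)])
  fix \<A> assume \<A>: "\<A> \<in> \<AA>"
  have bdd: "bdd_below (f ` \<B>)" "bdd_below (g ` \<B>)" if "\<B> \<in> \<AA>" for \<B>
  proof -
    show "bdd_below (f ` \<B>)"
      using f that by (intro bdd_belowI2[of _ "- B"]) (simp add: abs_le_iff minus_le_iff, blast)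
    show "bdd_below (g ` \<B>)"
      using g that by (intro bdd_belowI2[of _ "- C"]) (simp add: abs_le_iff minus_le_iff, blast)
  qed
  have "bdd_above ((\<lambda>\<A>. INF A\<in>\<A>. g A) ` \<AA>)"
  proof (rule bdd_aboveI2)
    fix \<B> assume \<B>: "\<B> \<in> \<AA>"
    then obtain A where "A \<in> \<B>" using ne(2) by blast
    then show "(INF A\<in>\<B>. g A) \<le> C"
      using cINF_lower[OF bdd(2)[OF \<B>], of A] g[of A] \<B> by fastforce
  qed
  then have "(INF A\<in>\<A>. g A) \<le> (SUP \<A>\<in>\<AA>. INF A\<in>\<A>. g A)"
    by (rule cSUP_upper[OF \<A>])
  \<comment> \<open>Solving for the infimum of \<open>g\<close> reduces the claim to a lower bound
    valid for every single \<open>A\<close>.\<close>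
  moreover have "((INF A\<in>\<A>. f A) - c) / k \<le> (INF A\<in>\<A>. g A)"
  proof (rule cINF_greatest[OF ne(2)[OF \<A>]])
    fix A assume "A \<in> \<A>"
    then have "(INF A\<in>\<A>. f A) \<le> k * g A + c"
      using cINF_lower[OF bdd(1)[OF \<A>], of A] le[of A] \<A> by fastforce
    then show "((INF A\<in>\<A>. f A) - c) / k \<le> g A"
      using k by (simp add: field_simps)
  qed
  ultimately have "((INF A\<in>\<A>. f A) - c) / k \<le> (SUP \<A>\<in>\<AA>. INF A\<in>\<A>. g A)" by linarith
  then show "(INF A\<in>\<A>. f A) \<le> k * (SUP \<A>\<in>\<AA>. INF A\<in>\<A>. g A) + c"
    using k by (simp add: field_simps)
qed

text \<open>Closeness splits into two affine inequalities, one for \<open>f\<close> in terms of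
  \<open>g\<close> and one for \<open>g\<close> in terms of \<open>f\<close>. A bound on
  \<open>g\<close> follows from that on \<open>f\<close>.\<close>

lemma SUP_INF_close:
  fixes f g :: "'a \<Rightarrow> real"
  assumes ne: "\<AA> \<noteq> {}" "\<And>\<A>. \<A> \<in> \<AA> \<Longrightarrow> \<A> \<noteq> {}" and k: "k > 0"
    and close: "\<And>A. A \<in> \<Union>\<AA> \<Longrightarrow> \<bar>f A - k * g A\<bar> \<le> c"
    and f: "bounded (f ` \<Union>\<AA>)"
  shows "\<bar>(SUP \<A>\<in>\<AA>. INF A\<in>\<A>. f A) - k * (SUP \<A>\<in>\<AA>. INF A\<in>\<A>. g A)\<bar> \<le> c"
proof -
  obtain B where B: "\<And>A. A \<in> \<Union>\<AA> \<Longrightarrow> \<bar>f A\<bar> \<le> B"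
    using f unfolding bounded_iff by (metis imageI real_norm_def)
  have C: "\<bar>g A\<bar> \<le> (B + c) / k" if "A \<in> \<Union>\<AA>" for A
  proof -
    have "k * \<bar>g A\<bar> \<le> B + c"
      using B[OF that] close[OF that] k by (simp add: abs_mult[of k "g A", symmetric, unfolded abs_of_pos[OF k]])
    then show ?thesis using k by (simp add: field_simps)
  qed
  have "(SUP \<A>\<in>\<AA>. INF A\<in>\<A>. f A) \<le> k * (SUP \<A>\<in>\<AA>. INF A\<in>\<A>. g A) + c"
    using close by (intro SUP_INF_le_affine[OF ne k _ B C]) (fastforce simp: abs_le_iff)+
  moreover have "(SUP \<A>\<in>\<AA>. INF A\<in>\<A>. g A) \<le> 1 / k * (SUP \<A>\<in>\<AA>. INF A\<in>\<A>. f A) + c / k"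
  proof (rule SUP_INF_le_affine[OF ne _ _ C B])
    fix A assume "A \<in> \<Union>\<AA>"
    then have "k * g A \<le> f A + c" using close[of A] by linarith
    then show "g A \<le> 1 / k * f A + c / k" using k by (simp add: field_simps)
  qed (use k in auto)
  then have "k * (SUP \<A>\<in>\<AA>. INF A\<in>\<A>. g A) \<le> (SUP \<A>\<in>\<AA>. INF A\<in>\<A>. f A) + c"
    using k by (simp add: field_simps)
  ultimately show ?thesis by linarith
qed

text \<open>The expression is continuous in \<open>A\<close>, and the closure of a bounded set of
  matrices is compact.\<close>

lemma bounded_trace_conjugate:
  fixes H :: "real ^ 'n ^ 'n"
  assumes "bounded S"
  shows "bounded ((\<lambda>A. trace (transpose A ** H ** A)) ` S)"
proof (rule bounded_subset)
  have "continuous_on (closure S) (\<lambda>A. trace (transpose A ** H ** A))"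
    unfolding trace_def matrix_matrix_mult_def transpose_def
    by (simp, intro continuous_intros)
  then show "bounded ((\<lambda>A. trace (transpose A ** H ** A)) ` closure S)"
    using assms by (intro compact_imp_bounded compact_continuous_image) auto
  show "(\<lambda>A. trace (transpose A ** H ** A)) ` S \<subseteq> (\<lambda>A. trace (transpose A ** H ** A)) ` closure S"
    by (intro image_mono closure_subset)
qed

theorem theorem1p6:
  fixes \<Omega> :: "(real ^ 'n) set"
    and u :: "real ^ 'n \<Rightarrow> real"
    and \<AA> :: "real ^ 'n \<Rightarrow> (real ^ 'n ^ 'n) set set"
    and F :: "real ^ 'n \<Rightarrow> real ^ 'n ^ 'n \<Rightarrow> real"
  assumes "open \<Omega>"
    and "C2_on \<Omega> u"
    and "\<And>x. x \<in> \<Omega> \<Longrightarrow> \<AA> x \<noteq> {}"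
    and "\<And>x \<A>. x \<in> \<Omega> \<Longrightarrow> \<A> \<in> \<AA> x \<Longrightarrow> \<A> \<subseteq> psd_mats \<and> \<A> \<noteq> {}"
    and "\<And>x. x \<in> \<Omega> \<Longrightarrow> bounded (\<Union> (\<AA> x))"
    and "\<And>x M. x \<in> \<Omega> \<Longrightarrow> M \<in> sym_mats \<Longrightarrow>
           F x M = (SUP \<A> \<in> \<AA> x. INF A \<in> \<A>. trace (transpose A ** M ** A))"
  shows "\<forall>x\<in>\<Omega>.
    (\<lambda>\<epsilon>. F x (hessian u x)
        - 2 * (real CARD('n) + 2) *
          (SUP \<A> \<in> \<AA> x. INF A \<in> \<A>.
             1 / measure lebesgue (ball (0 :: real ^ 'n) \<epsilon>) *
             (LINT y : ball 0 \<epsilon> | lebesgue. (u (x + A *v y) - u x) / \<epsilon>\<^sup>2)))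
      \<in> o[at_right 0](\<lambda>_. 1)"
proof (intro ballI landau_o.smallI)
  fix x and c :: real assume x: "x \<in> \<Omega>" and c: "c > 0"
  obtain b where b: "b > 0" "\<And>A. A \<in> \<Union>(\<AA> x) \<Longrightarrow> norm A \<le> b"
    using assms(5)[OF x] unfolding bounded_pos by blast
  \<comment> \<open>\<open>K\<close> bounds the operator norm of all admissible matrices at
    \<open>x\<close> simultaneously, and \<open>e\<close> below is chosen so that the averaged error
    \<open>m * e * K\<^sup>2\<close> is exactly \<open>c\<close>.\<close>
  define K where "K = real CARD('n) * real CARD('n) * b"
  have K: "K > 0" using b by (simp add: K_def)
  define m where "m = 2 * (real CARD('n) + 2)"
  have m: "m > 0" by (simp add: m_def add_pos_pos)
  define e where "e = c / (m * K\<^sup>2)"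
  have e: "e > 0" using c m K by (simp add: e_def)
  obtain d where d: "d > 0" "ball x d \<subseteq> \<Omega>" and taylor:
    "\<And>h. norm h < d \<Longrightarrow>
      \<bar>u (x + h) - u x - frechet_derivative u (at x) h - (h \<bullet> (hessian u x *v h)) / 2\<bar> \<le> e * (norm h)\<^sup>2"
    using C2_on_taylor2[OF assms(1,2) x e] by metis
  have diff: "u differentiable (at y)" if "y \<in> \<Omega>" for y
    using assms(2) that by (auto simp: C2_on_def)
  then have cont: "continuous_on (ball x d) u"
    using d(2) by (auto intro!: continuous_at_imp_continuous_on differentiable_imp_continuous_within)
  \<comment> \<open>For these radii \<open>K * r < d\<close>, so a single range of radii serves
    every admissible \<open>A\<close>.\<close>
  have "\<forall>\<^sub>F r in at_right 0. 0 < r \<and> r < d / K"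
    using d K by (auto simp: eventually_at_right_field intro!: exI[of _ "d / K"])
  then show "\<forall>\<^sub>F \<epsilon> in at_right 0. norm (F x (hessian u x)
        - 2 * (real CARD('n) + 2) *
          (SUP \<A> \<in> \<AA> x. INF A \<in> \<A>.
             1 / measure lebesgue (ball (0 :: real ^ 'n) \<epsilon>) *
             (LINT y : ball 0 \<epsilon> | lebesgue. (u (x + A *v y) - u x) / \<epsilon>\<^sup>2))) \<le> c * norm (1::real)"
  proof (rule eventually_mono)
    fix r assume r: "0 < r \<and> r < d / K"
    let ?g = "\<lambda>A. 1 / measure lebesgue (ball (0 :: real ^ 'n) r) *
             (LINT y : ball 0 r | lebesgue. (u (x + A *v y) - u x) / r\<^sup>2)"
    have "\<bar>trace (transpose A ** hessian u x ** A) - m * ?g A\<bar> \<le> c" if "A \<in> \<Union>(\<AA> x)" for A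
    proof -
      have "norm (A *v y) \<le> K * norm y" for y
        unfolding K_def by (rule norm_matrix_vector_mult_le[OF b(2)[OF that]])
      moreover have "K * r < d" using r K by (simp add: field_simps)
      ultimately have "\<bar>trace (transpose A ** hessian u x ** A) - m * ?g A\<bar> \<le> m * e * K\<^sup>2"
        unfolding m_def using r e K
        by (intro ball_average_expansion[OF _ _ _ _ _ cont linear_frechet_derivative[OF diff[OF x]] taylor]) auto
      then show ?thesis using m K by (simp add: e_def)
    qed
    then have "\<bar>(SUP \<A>\<in>\<AA> x. INF A\<in>\<A>. trace (transpose A ** hessian u x ** A))
        - m * (SUP \<A>\<in>\<AA> x. INF A\<in>\<A>. ?g A)\<bar> \<le> c"
      using assms(3,4)[OF x] m
      by (intro SUP_INF_close bounded_trace_conjugate assms(5) x) auto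
    then show "norm (F x (hessian u x) - 2 * (real CARD('n) + 2) *
        (SUP \<A>\<in>\<AA> x. INF A\<in>\<A>. ?g A)) \<le> c * norm (1::real)"
      using assms(6)[OF x hessian_symmetric[OF assms(1,2) x]] by (simp add: m_def)
  qed
qed

end
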